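(* Let $f$ be a smooth vector field on $\mathbb{R}^D$. Consider a consistent implicit Runge–Kutta scheme $\Phi_h$ and denote its inverse modified differential equation (IMDE) for $f$ by $\hat f_h=\sum_{k=0}^\infty h^k\hat f_k$, and let $f_h=\sum_{k=0}^\infty h^kf_k$ be the IMDE for $f$ of the unrolled approximation $\Phi_h^L$, obtained by $L$ steps of either fixed-point iteration or Newton–Raphson iteration. Then $$\hat f_h-f_h=\mathcal{O}(h^{L^*+1}),\quad\text{i.e.}\quad \hat f_k=f_k\ \text{ for } k=0,\dots,L^*,$$ where $L^*=L$ for the unrolled approximation using fixed-point iteration and $L^*=2^{L+1}-2$ for the unrolled approximation using Newton–Raphson iteration.
   Context: Runge–Kutta scheme: with coefficients $a_{ij},b_i$ ($1\le i,j\le I$), for a vector field $g$, $\boldsymbol v_i=\boldsymbol x+h\sum_{j=1}^I a_{ij}g(\boldsymbol v_j)$ $(i=1,\dots,I)$, $\Phi_{h,g}(\boldsymbol x)=\boldsymbol x+h\sum_{i=1}^I b_ig(\boldsymbol v_i)$. It is explicit only if $a_{ij}=0$ for $i\le j$, otherwise implicit. Consistent means $\sum_i b_i=1$. Unrolled approximation $\Phi^L_{h,g}$: set $\boldsymbol v_i^0=\boldsymbol x$, and for $l=1,\dots,L$, either (fixed-point iteration) $\boldsymbol v_i^l=\boldsymbol x+h\sum_j a_{ij}g(\boldsymbol v_j^{l-1})$, or (Newton–Raphson iteration) $\boldsymbol v_i^l=\boldsymbol x+h\sum_j a_{ij}\big(g(\boldsymbol v_j^{l-1})+g'(\boldsymbol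 v_j^{l-1})(\boldsymbol v_j^l-\boldsymbol v_j^{l-1})\big)$ (a linear system for $(\boldsymbol v_j^l)_j$); then $\Phi^L_{h,g}(\boldsymbol x)=\boldsymbol x+h\sum_i b_ig(\boldsymbol v_i^L)$. IMDE: let $\phi_{t,f}$ be the time-$t$ flow of $\dot{\boldsymbol y}=f(\boldsymbol y)$. The IMDE of a consistent one-step scheme $\Psi_h$ (here $\Psi_h=\Phi_h$ or $\Phi_h^L$) for $f$ is the formal vector field $f_h=\sum_{k\ge0}h^kf_k$ such that $\Psi_{h,f_h}(\boldsymbol x)=\phi_{h,f}(\boldsymbol x)$ as formal power series in $h$. Since the coefficient of $h^{k+1}$ in the expansion of $\Psi_{h,f_h}(\boldsymbol x)$ is $f_k(\boldsymbol x)$ plus terms built from $f_j$, $j<k$, and their derivatives, the $f_k$ are determined recursively and uniquely from $f$ and its derivatives. All series are understood formally; $\mathcal{O}(h^{L^*+1})$ means that the coefficients of $h^0,\dots,h^{L^*}$ vanish. *)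

theory Defs
  imports "HOL-Analysis.Analysis" "HOL-Computational_Algebra.Formal_Power_Series"
begin

section \<open>Smooth vector fields and local flows\<close>

primrec higher_differentiable ::
    "nat \<Rightarrow> ('a::real_normed_vector \<Rightarrow> 'b::real_normed_vector) \<Rightarrow> bool" where
  "higher_differentiable 0 f \<longleftrightarrow> continuous_on UNIV f"
| "higher_differentiable (Suc n) f \<longleftrightarrow>
     (\<forall>x. f differentiable (at x)) \<and>
     (\<forall>u. higher_differentiable n (\<lambda>x. frechet_derivative f (at x) u))"

definition smooth :: "('a::real_normed_vector \<Rightarrow> 'b::real_normed_vector) \<Rightarrow> bool" where
  "smooth f \<longleftrightarrow> (\<forall>n. higher_differentiable n f)"

text \<open>
  The flow of a smooth field need not be complete, so \<open>\<phi> t x\<close> is only constrained for \<open>t\<close> in a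
  neighbourhood of \<open>0\<close> that may depend on \<open>x\<close>. Existence and uniqueness of solutions determine the
  germ of \<open>\<phi> t x\<close> at \<open>t = 0\<close>, which is all that enters the Taylor series below.
\<close>
definition local_flow :: "(real ^ 'd \<Rightarrow> real ^ 'd) \<Rightarrow> (real \<Rightarrow> real ^ 'd \<Rightarrow> real ^ 'd) \<Rightarrow> bool" where
  "local_flow f \<phi> \<longleftrightarrow>
     (\<forall>x. \<phi> 0 x = x \<and>
          (\<forall>\<^sub>F t in nhds 0. ((\<lambda>s. \<phi> s x) has_vector_derivative f (\<phi> t x)) (at t)))"

section \<open>Formal power series in the step size\<close>

text \<open>
  A formal curve in \<open>\<real>\<^sup>D\<close> is an element of the free module \<open>\<real>[[h]]\<^sup>D\<close>, with \<open>fps_X\<close> in the role of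
  the step size \<open>h\<close>; a formal vector field \<open>\<Sum>k. h\<^sup>k g\<^sub>k\<close> is the sequence \<open>g\<close> of its coefficients.
\<close>
type_synonym 'd formal_curve = "real fps ^ 'd"
type_synonym 'd formal_field = "nat \<Rightarrow> real ^ 'd \<Rightarrow> real ^ 'd"

definition const_curve :: "real ^ 'd \<Rightarrow> 'd formal_curve" where
  "const_curve x = (\<chi> d. fps_const (x $ d))"

definition taylor_series :: "(real \<Rightarrow> real ^ 'd) \<Rightarrow> 'd formal_curve" where
  "taylor_series u = (\<chi> d. Abs_fps (\<lambda>n. (deriv ^^ n) (\<lambda>t. u t $ d) 0 / fact n))"

definition truncated_curve :: "nat \<Rightarrow> 'd formal_curve \<Rightarrow> real \<Rightarrow> real ^ 'd" where
  "truncated_curve n v h = (\<chi> d. \<Sum>j\<le>n. fps_nth (v $ d) j * h ^ j)"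

text \<open>
  Formal substitution \<open>g\<^sub>h(v\<^sub>h)\<close>. Terms of \<open>g\<close> and \<open>v\<close> of order above \<open>n\<close> do not contribute to the
  coefficient of \<open>h\<^sup>n\<close>, which is therefore the \<open>n\<close>-th Taylor coefficient of the genuine smooth
  function of \<open>h\<close> obtained by truncating both series after order \<open>n\<close>.
\<close>
definition formal_eval :: "'d::finite formal_field \<Rightarrow> 'd formal_curve \<Rightarrow> 'd formal_curve" where
  "formal_eval g v = (\<chi> d. Abs_fps (\<lambda>n.
     fps_nth (taylor_series (\<lambda>h. \<Sum>k\<le>n. h ^ k *\<^sub>R g k (truncated_curve n v h)) $ d) n))"

text \<open>
  The Jacobian matrix \<open>g\<^sub>h'(v\<^sub>h)\<close> with entries in \<open>\<real>[[h]]\<close>; its \<open>j\<close>-th column is the \<open>j\<close>-th partial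
  derivative of \<open>g\<close>, evaluated at \<open>v\<close>.
\<close>
definition formal_jacobian :: "'d::finite formal_field \<Rightarrow> 'd formal_curve \<Rightarrow> real fps ^ 'd ^ 'd" where
  "formal_jacobian g v =
     (\<chi> i j. formal_eval (\<lambda>k x. frechet_derivative (g k) (at x) (axis j 1)) v $ i)"

section \<open>Runge--Kutta schemes and their unrolled approximations\<close>

definition rk_consistent :: "nat \<Rightarrow> (nat \<Rightarrow> real) \<Rightarrow> bool" where
  "rk_consistent s b \<longleftrightarrow> (\<Sum>i=1..s. b i) = 1"

definition rk_explicit :: "nat \<Rightarrow> (nat \<Rightarrow> nat \<Rightarrow> real) \<Rightarrow> bool" where
  "rk_explicit s a \<longleftrightarrow> (\<forall>i\<in>{1..s}. \<forall>j\<in>{1..s}. i \<le> j \<longrightarrow> a i j = 0)"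

abbreviation rk_implicit :: "nat \<Rightarrow> (nat \<Rightarrow> nat \<Rightarrow> real) \<Rightarrow> bool" where
  "rk_implicit s a \<equiv> \<not> rk_explicit s a"

definition rk_output ::
    "nat \<Rightarrow> (nat \<Rightarrow> real) \<Rightarrow> 'd formal_field \<Rightarrow> real ^ 'd \<Rightarrow> (nat \<Rightarrow> 'd formal_curve) \<Rightarrow> 'd formal_curve"
  where
  "rk_output s b g x v =
     const_curve x + fps_X *s (\<Sum>i=1..s. fps_const (b i) *s formal_eval g (v i))"

text \<open>
  A scheme is represented by the relation ``\<open>P\<close> is the expansion in \<open>h\<close> of \<open>\<Psi>\<^bsub>h,g\<^esub>(x)\<close>'', since the
  stages are given only implicitly. Because of the factor \<open>h\<close> in front of the stage sums, the stage
  equations below have exactly one formal solution, which the existential quantifiers pick out.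
\<close>
type_synonym 'd formal_scheme = "'d formal_field \<Rightarrow> real ^ 'd \<Rightarrow> 'd formal_curve \<Rightarrow> bool"

definition rk_scheme :: "nat \<Rightarrow> (nat \<Rightarrow> nat \<Rightarrow> real) \<Rightarrow> (nat \<Rightarrow> real) \<Rightarrow> 'd::finite formal_scheme" where
  "rk_scheme s a b g x P \<longleftrightarrow>
     (\<exists>v. (\<forall>i\<in>{1..s}. v i = const_curve x +
             fps_X *s (\<Sum>j=1..s. fps_const (a i j) *s formal_eval g (v j))) \<and>
          P = rk_output s b g x v)"

datatype iteration = Fixed_Point | Newton_Raphson

text \<open>One iteration, leading from the stages \<open>v\<close> to the stages \<open>w\<close>.\<close>
fun iteration_step ::
    "iteration \<Rightarrow> nat \<Rightarrow> (nat \<Rightarrow> nat \<Rightarrow> real) \<Rightarrow> 'd::finite formal_field \<Rightarrow> real ^ 'd \<Rightarrow>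
     (nat \<Rightarrow> 'd formal_curve) \<Rightarrow> (nat \<Rightarrow> 'd formal_curve) \<Rightarrow> bool" where
  "iteration_step Fixed_Point s a g x v w \<longleftrightarrow>
     (\<forall>i\<in>{1..s}. w i = const_curve x +
        fps_X *s (\<Sum>j=1..s. fps_const (a i j) *s formal_eval g (v j)))"
| "iteration_step Newton_Raphson s a g x v w \<longleftrightarrow>
     (\<forall>i\<in>{1..s}. w i = const_curve x +
        fps_X *s (\<Sum>j=1..s. fps_const (a i j) *s
          (formal_eval g (v j) + formal_jacobian g (v j) *v (w j - v j))))"

definition unrolled_scheme ::
    "iteration \<Rightarrow> nat \<Rightarrow> nat \<Rightarrow> (nat \<Rightarrow> nat \<Rightarrow> real) \<Rightarrow> (nat \<Rightarrow> real) \<Rightarrow> 'd::finite formal_scheme" where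
  "unrolled_scheme M L s a b g x P \<longleftrightarrow>
     (\<exists>v. (\<forall>i\<in>{1..s}. v 0 i = const_curve x) \<and>
          (\<forall>l\<in>{1..L}. iteration_step M s a g x (v (l - 1)) (v l)) \<and>
          P = rk_output s b g x (v L))"

section \<open>Inverse modified differential equations\<close>

text \<open>\<open>F\<close> is the IMDE of the scheme \<open>\<Psi>\<close> for the vector field with flow \<open>\<phi>\<close>:
  \<open>\<Psi>\<^bsub>h,F\<^esub>(x) = \<phi>\<^bsub>h\<^esub>(x)\<close> as formal power series in \<open>h\<close>, for every \<open>x\<close>.\<close>
definition is_IMDE ::
    "'d formal_scheme \<Rightarrow> (real \<Rightarrow> real ^ 'd \<Rightarrow> real ^ 'd) \<Rightarrow> 'd formal_field \<Rightarrow> bool" where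
  "is_IMDE \<Psi> \<phi> F \<longleftrightarrow>
     (\<forall>k. smooth (F k)) \<and> (\<forall>x. \<Psi> F x (taylor_series (\<lambda>t. \<phi> t x)))"

end

theory Submission
  imports Defs
begin

text \<open>
  By induction on \<open>k\<close>, let \<open>f_hat\<close> and \<open>f_unr\<close> agree below order \<open>k\<close>. Because of the factor \<open>h\<close> in
  the stage equations, the stages of the implicit scheme for \<open>f_hat\<close> then solve the stage equations
  for \<open>f_unr\<close> modulo \<open>h ^ (k + 1)\<close>. Iterating towards them, an error \<open>O(h ^ p)\<close> of the stages
  becomes \<open>O(h ^ (p + 1))\<close> in a fixed-point step and \<open>O(h ^ (2 * p + 1))\<close> in a Newton--Raphson step;
  starting from \<open>p = 1\<close>, the error after \<open>L\<close> steps is \<open>O(h ^ (L + 1))\<close> or \<open>O(h ^ (2 ^ (L + 1) - 1))\<close>.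
  Hence for the asserted \<open>k\<close> the stages agree modulo \<open>h ^ (k + 1)\<close>, and comparing the coefficients of
  \<open>h ^ (k + 1)\<close> of the two outputs leaves \<open>(\<Sum>i. b i) * (f_hat k x - f_unr k x) = 0\<close>.

  The substitution of formal curves into smooth fields is controlled without Taylor's theorem: the
  chain rule expresses the coefficients of the derivative of \<open>g \<circ> c\<close> through those of the fields
  \<open>partial j g \<circ> c\<close>, so statements about Taylor coefficients follow by induction on the order,
  simultaneously for all smooth \<open>g\<close>.
\<close>

section \<open>Smooth real functions and their Taylor series\<close>

text \<open>Built on \<open>deriv\<close> because \<open>taylor_series\<close> iterates
  \<open>deriv\<close> on each component. As \<open>deriv\<close> is total, existence of the
  derivative is demanded separately.\<close>

primrec times_differentiable :: "nat \<Rightarrow> (real \<Rightarrow> real) \<Rightarrow> bool" where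
  "times_differentiable 0 u \<longleftrightarrow> True"
| "times_differentiable (Suc n) u \<longleftrightarrow>
     (\<forall>x. (u has_real_derivative deriv u x) (at x)) \<and> times_differentiable n (deriv u)"

definition smooth_real :: "(real \<Rightarrow> real) \<Rightarrow> bool" where
  "smooth_real u \<longleftrightarrow> (\<forall>n. times_differentiable n u)"

text \<open>Derivatives are unique, so any candidate \<open>u'\<close> will do; the closure proofs
  supply it by the usual differentiation rules.\<close>

lemma times_differentiable_SucI:
  assumes "\<And>x. (u has_real_derivative u' x) (at x)" "times_differentiable n u'"
  shows "times_differentiable (Suc n) u"
proof -
  have "deriv u = u'"
    using assms(1) DERIV_imp_deriv by blast
  then show ?thesis
    using assms by simp
qed

lemma times_differentiable_SucD: "times_differentiable (Suc n) u \<Longrightarrow> times_differentiable n u"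
  by (induction n arbitrary: u) auto

lemma smooth_real_has_derivative:
  "smooth_real u \<Longrightarrow> (u has_real_derivative deriv u x) (at x)"
  unfolding smooth_real_def by (metis times_differentiable.simps(2))

lemma smooth_real_deriv: "smooth_real u \<Longrightarrow> smooth_real (deriv u)"
  unfolding smooth_real_def by (metis times_differentiable.simps(2))

lemma times_differentiable_const: "times_differentiable n (\<lambda>_. c)"
  by (induction n arbitrary: c)
    (auto intro!: times_differentiable_SucI derivative_eq_intros simp del: times_differentiable.simps(2))

lemma times_differentiable_ident: "times_differentiable n (\<lambda>x. x)"
  by (cases n)
    (auto intro!: times_differentiable_SucI[where u' = "\<lambda>_. 1"] times_differentiable_const
      simp del: times_differentiable.simps(2))

lemma times_differentiable_add:
  "times_differentiable n u \<Longrightarrow> times_differentiable n v \<Longrightarrow> times_differentiable n (\<lambda>x. u x + v x)"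
proof (induction n arbitrary: u v)
  case (Suc n)
  show ?case
    by (rule times_differentiable_SucI[where u' = "\<lambda>x. deriv u x + deriv v x"])
      (use Suc in \<open>auto intro!: derivative_eq_intros\<close>)
qed auto

text \<open>The product rule leaves one factor of each term undifferentiated; its order is lowered
  from \<open>Suc n\<close> to \<open>n\<close> before the induction hypothesis applies.\<close>

lemma times_differentiable_mult:
  "times_differentiable n u \<Longrightarrow> times_differentiable n v \<Longrightarrow> times_differentiable n (\<lambda>x. u x * v x)"
proof (induction n arbitrary: u v)
  case (Suc n)
  have "times_differentiable n (\<lambda>x. deriv u x * v x + u x * deriv v x)"
    using Suc times_differentiable_SucD by (intro times_differentiable_add Suc.IH) auto
  then show ?case
    by (rule times_differentiable_SucI[rotated])
      (use Suc in \<open>auto intro!: derivative_eq_intros\<close>)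
qed auto

lemma times_differentiable_sum:
  "(\<And>i. i \<in> A \<Longrightarrow> times_differentiable n (u i)) \<Longrightarrow> times_differentiable n (\<lambda>x. \<Sum>i\<in>A. u i x)"
  by (induction A rule: infinite_finite_induct)
    (auto intro: times_differentiable_add times_differentiable_const)

lemma smooth_real_const: "smooth_real (\<lambda>_. c)"
  and smooth_real_ident: "smooth_real (\<lambda>x. x)"
  and smooth_real_add: "smooth_real u \<Longrightarrow> smooth_real v \<Longrightarrow> smooth_real (\<lambda>x. u x + v x)"
  and smooth_real_mult: "smooth_real u \<Longrightarrow> smooth_real v \<Longrightarrow> smooth_real (\<lambda>x. u x * v x)"
  and smooth_real_sum: "(\<And>i. i \<in> A \<Longrightarrow> smooth_real (w i)) \<Longrightarrow> smooth_real (\<lambda>x. \<Sum>i\<in>A. w i x)"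
  unfolding smooth_real_def
  by (auto intro: times_differentiable_const times_differentiable_ident times_differentiable_add
      times_differentiable_mult times_differentiable_sum)

lemma smooth_real_diff:
  "smooth_real u \<Longrightarrow> smooth_real v \<Longrightarrow> smooth_real (\<lambda>x. u x - v x)"
  using smooth_real_add[of u "\<lambda>x. (-1) * v x"] smooth_real_mult[OF smooth_real_const, of v "-1"] by simp

lemma smooth_real_power: "smooth_real (\<lambda>x. x ^ k)"
  by (induction k) (auto intro: smooth_real_const smooth_real_mult smooth_real_ident)

lemmas smooth_real_intros = smooth_real_const smooth_real_ident smooth_real_add smooth_real_mult
  smooth_real_sum smooth_real_diff smooth_real_power smooth_real_deriv

section \<open>Taylor expansion at 0 as a ring homomorphism from smooth real functions to power
  series\<close>

definition taylor_fps :: "(real \<Rightarrow> real) \<Rightarrow> real fps" where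
  "taylor_fps u = Abs_fps (\<lambda>n. (deriv ^^ n) u 0 / fact n)"

lemma taylor_series_nth: "taylor_series u $ d = taylor_fps (\<lambda>t. u t $ d)"
  by (simp add: taylor_series_def taylor_fps_def)

lemma taylor_fps_nth_0 [simp]: "fps_nth (taylor_fps u) 0 = u 0"
  by (simp add: taylor_fps_def)

text \<open>Trades one order of the coefficient for one derivative of the function; the inductions
  on the order rest on this recursion.\<close>

lemma taylor_fps_nth_Suc:
  "fps_nth (taylor_fps u) (Suc n) = fps_nth (taylor_fps (deriv u)) n / real (Suc n)"
  by (simp add: taylor_fps_def funpow_swap1 del: of_nat_Suc)

lemma fps_deriv_taylor_fps: "fps_deriv (taylor_fps u) = taylor_fps (deriv u)"
  by (rule fps_ext) (simp add: taylor_fps_nth_Suc del: of_nat_Suc)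

lemma deriv_eqI: "(\<And>x. (u has_real_derivative u' x) (at x)) \<Longrightarrow> deriv u = u'"
  using DERIV_imp_deriv by blast

lemma taylor_fps_const: "taylor_fps (\<lambda>_. c) = fps_const c"
proof (rule fps_ext)
  show "fps_nth (taylor_fps (\<lambda>_. c)) n = fps_nth (fps_const c) n" for n
    by (induction n arbitrary: c) (simp_all add: taylor_fps_nth_Suc)
qed

lemma taylor_fps_ident: "taylor_fps (\<lambda>x. x) = fps_X"
proof (rule fps_ext)
  show "fps_nth (taylor_fps (\<lambda>x. x)) n = fps_nth fps_X n" for n
    by (cases n) (simp_all add: taylor_fps_nth_Suc taylor_fps_const fps_X_def)
qed

lemma taylor_fps_add:
  assumes "smooth_real u" "smooth_real v"
  shows "taylor_fps (\<lambda>x. u x + v x) = taylor_fps u + taylor_fps v"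
proof (rule fps_ext)
  show "fps_nth (taylor_fps (\<lambda>x. u x + v x)) n = fps_nth (taylor_fps u + taylor_fps v) n" for n
    using assms
  proof (induction n arbitrary: u v)
    case (Suc n)
    have "deriv (\<lambda>x. u x + v x) = (\<lambda>x. deriv u x + deriv v x)"
      using Suc.prems by (intro deriv_eqI derivative_intros smooth_real_has_derivative)
    with Suc.IH[of "deriv u" "deriv v"] Suc.prems show ?case
      by (simp add: taylor_fps_nth_Suc smooth_real_deriv add_divide_distrib)
  qed simp
qed

text \<open>Both sides obey the Leibniz rule: coefficient \<open>Suc n\<close> of each is
  coefficient \<open>n\<close> of its derivative up to the factor \<open>Suc n\<close>, and there
  the induction hypothesis applies to both products.\<close>

lemma taylor_fps_mult:
  assumes "smooth_real u" "smooth_real v"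
  shows "taylor_fps (\<lambda>x. u x * v x) = taylor_fps u * taylor_fps v"
proof (rule fps_ext)
  show "fps_nth (taylor_fps (\<lambda>x. u x * v x)) n = fps_nth (taylor_fps u * taylor_fps v) n" for n
    using assms
  proof (induction n arbitrary: u v)
    case (Suc n)
    have "deriv (\<lambda>x. u x * v x) = (\<lambda>x. deriv u x * v x + u x * deriv v x)"
      using Suc.prems smooth_real_has_derivative
      by (intro deriv_eqI) (auto intro!: derivative_eq_intros)
    then have "real (Suc n) * fps_nth (taylor_fps (\<lambda>x. u x * v x)) (Suc n) =
        fps_nth (taylor_fps (deriv u) * taylor_fps v + taylor_fps u * taylor_fps (deriv v)) n"
      using Suc by (simp add: taylor_fps_nth_Suc taylor_fps_add smooth_real_intros del: of_nat_Suc)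
    also have "\<dots> = fps_nth (fps_deriv (taylor_fps u * taylor_fps v)) n"
      by (simp add: fps_deriv_taylor_fps add.commute)
    also have "\<dots> = real (Suc n) * fps_nth (taylor_fps u * taylor_fps v) (Suc n)"
      by (metis fps_deriv_nth Suc_eq_plus1)
    finally show ?case by simp
  qed simp
qed

lemma taylor_fps_sum:
  "(\<And>i. i \<in> A \<Longrightarrow> smooth_real (u i)) \<Longrightarrow>
   taylor_fps (\<lambda>x. \<Sum>i\<in>A. u i x) = (\<Sum>i\<in>A. taylor_fps (u i))"
  by (induction A rule: infinite_finite_induct)
    (auto simp: taylor_fps_const taylor_fps_add smooth_real_sum)

lemma taylor_fps_diff:
  assumes "smooth_real u" "smooth_real v"
  shows "taylor_fps (\<lambda>x. u x - v x) = taylor_fps u - taylor_fps v"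
  using taylor_fps_add[OF smooth_real_diff[OF assms] assms(2)] by simp

lemma taylor_fps_power: "taylor_fps (\<lambda>x. x ^ k) = fps_X ^ k"
  by (induction k)
    (auto simp: taylor_fps_const taylor_fps_mult smooth_real_intros taylor_fps_ident)

lemma smooth_truncated_curve: "smooth_real (\<lambda>h. truncated_curve n v h $ d)"
  by (simp add: truncated_curve_def smooth_real_intros)

text \<open>A truncated curve is a polynomial in \<open>h\<close>, so its Taylor coefficients can be
  read off.\<close>

lemma taylor_fps_truncated_curve:
  "m \<le> n \<Longrightarrow> fps_nth (taylor_fps (\<lambda>h. truncated_curve n v h $ d)) m = fps_nth (v $ d) m"
  by (simp add: truncated_curve_def taylor_fps_sum taylor_fps_mult taylor_fps_const taylor_fps_power
      smooth_real_intros fps_sum_nth if_distrib[of "\<lambda>x. _ * x"] cong: if_cong)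

section \<open>Compositions of smooth fields with smooth curves\<close>

abbreviation partial :: "'d \<Rightarrow> (real ^ 'd \<Rightarrow> real ^ 'd) \<Rightarrow> real ^ 'd \<Rightarrow> real ^ 'd::finite" where
  "partial j g \<equiv> \<lambda>x. frechet_derivative g (at x) (axis j 1)"

lemma smooth_directional: "smooth g \<Longrightarrow> smooth (\<lambda>x. frechet_derivative g (at x) u)"
  unfolding smooth_def by (metis higher_differentiable.simps(2))

lemma smooth_has_derivative: "smooth g \<Longrightarrow> (g has_derivative frechet_derivative g (at x)) (at x)"
  unfolding smooth_def by (metis higher_differentiable.simps(2) frechet_derivative_works)

lemma smooth_continuous: "smooth g \<Longrightarrow> continuous_on UNIV g"
  unfolding smooth_def by (metis higher_differentiable.simps(1))

definition smooth_curve :: "(real \<Rightarrow> real ^ 'd) \<Rightarrow> bool" where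
  "smooth_curve c \<longleftrightarrow> (\<forall>d. smooth_real (\<lambda>h. c h $ d))"

lemma smooth_curveD: "smooth_curve c \<Longrightarrow> smooth_real (\<lambda>h. c h $ d)"
  by (simp add: smooth_curve_def)

text \<open>The total derivative is expanded along the coordinate axes, so that only composites of
  \<open>c\<close> with the fields \<open>partial j g\<close> occur. These fields are again smooth,
  which permits inductions with \<open>g\<close> arbitrary.\<close>

lemma smooth_comp_has_derivative:
  fixes g :: "real ^ 'd \<Rightarrow> real ^ 'd::finite"
  assumes "smooth g" "smooth_curve c"
  shows "((\<lambda>h. g (c h) $ i) has_real_derivative
           (\<Sum>j\<in>UNIV. partial j g (c h) $ i * deriv (\<lambda>h. c h $ j) h)) (at h)"
proof -
  define c' where "c' = (\<chi> j. deriv (\<lambda>h. c h $ j) h)"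
  have "((\<lambda>h. c h $ j) has_derivative (\<lambda>t. t *\<^sub>R c' $ j)) (at h)" for j
    using smooth_real_has_derivative[OF smooth_curveD[OF assms(2)], of j h]
    by (auto simp: c'_def has_field_derivative_def mult.commute elim!: has_derivative_eq_rhs)
  then have "(c has_derivative (\<lambda>t. t *\<^sub>R c')) (at h)"
    by (subst has_derivative_componentwise_within)
      (auto simp: Basis_vec_def inner_axis)
  from diff_chain_at[OF this smooth_has_derivative[OF assms(1)]]
  have "((\<lambda>h. g (c h)) has_derivative (\<lambda>t. frechet_derivative g (at (c h)) (t *\<^sub>R c'))) (at h)"
    by (simp add: o_def)
  then have *: "((\<lambda>h. g (c h) $ i) has_derivative (\<lambda>t. frechet_derivative g (at (c h)) (t *\<^sub>R c') $ i)) (at h)"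
    by (rule bounded_linear.has_derivative[OF bounded_linear_vec_nth])
  have lin: "linear (frechet_derivative g (at (c h)))"
    using assms(1) smooth_has_derivative has_derivative_linear by blast
  have "frechet_derivative g (at (c h)) (t *\<^sub>R c') $ i
      = t * (\<Sum>j\<in>UNIV. partial j g (c h) $ i * deriv (\<lambda>h. c h $ j) h)" for t
  proof -
    have "t *\<^sub>R c' = t *\<^sub>R (\<Sum>j\<in>UNIV. c' $ j *\<^sub>R axis j 1)"
      using basis_expansion[of c'] by (simp add: scalar_mult_eq_scaleR)
    then have "frechet_derivative g (at (c h)) (t *\<^sub>R c')
        = t *\<^sub>R (\<Sum>j\<in>UNIV. c' $ j *\<^sub>R partial j g (c h))"
      using lin by (simp add: linear_sum linear_cmul)
    then show ?thesis
      by (simp add: c'_def mult.commute)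
  qed
  with * show ?thesis
    by (auto simp: has_field_derivative_def mult.commute elim!: has_derivative_eq_rhs)
qed

lemma smooth_comp:
  fixes g :: "real ^ 'd \<Rightarrow> real ^ 'd::finite"
  assumes "smooth g" "smooth_curve c"
  shows "smooth_real (\<lambda>h. g (c h) $ i)"
proof -
  have "times_differentiable n (\<lambda>h. g (c h) $ i)" for n
    using assms(1)
  proof (induction n arbitrary: g)
    case (Suc n)
    have "times_differentiable n (\<lambda>h. \<Sum>j\<in>UNIV. partial j g (c h) $ i * deriv (\<lambda>h. c h $ j) h)"
      using smooth_real_deriv[OF smooth_curveD[OF assms(2)]]
      by (auto intro!: times_differentiable_sum times_differentiable_mult Suc smooth_directional
          simp: smooth_real_def)
    then show ?case
      by (rule times_differentiable_SucI[OF smooth_comp_has_derivative[OF Suc.prems assms(2)]])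
  qed simp
  then show ?thesis by (simp add: smooth_real_def)
qed

lemmas smooth_comp_partial = smooth_comp[OF smooth_directional]

lemma fps_mult_nth_cong:
  assumes "\<And>m. m \<le> n \<Longrightarrow> fps_nth A m = fps_nth A' m" "\<And>m. m \<le> n \<Longrightarrow> fps_nth B m = fps_nth B' m"
  shows "fps_nth (A * B) n = fps_nth (A' * B') n"
  using assms by (auto simp: fps_mult_nth intro!: sum.cong)

text \<open>By the chain rule, coefficient \<open>Suc k\<close> of \<open>g\<close> along a curve
  depends on the coefficients up to \<open>k\<close> of the fields \<open>partial j g\<close> along
  it and of its derivative. Induction over all smooth \<open>g\<close> handles the former.\<close>

lemma taylor_fps_comp_cong:
  fixes g :: "real ^ 'd \<Rightarrow> real ^ 'd::finite"
  assumes "smooth g" and c: "smooth_curve c" and e: "smooth_curve e"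
    and "\<And>m d. m \<le> n \<Longrightarrow>
      fps_nth (taylor_fps (\<lambda>h. c h $ d)) m = fps_nth (taylor_fps (\<lambda>h. e h $ d)) m"
  shows "fps_nth (taylor_fps (\<lambda>h. g (c h) $ i)) n = fps_nth (taylor_fps (\<lambda>h. g (e h) $ i)) n"
  using assms(1,4)
proof (induction n arbitrary: g rule: less_induct)
  case (less n)
  show ?case
  proof (cases n)
    case 0
    then have "c 0 = e 0"
      using less.prems(2)[of 0] by (simp add: vec_eq_iff)
    with 0 show ?thesis by simp
  next
    case (Suc k)
    have *: "fps_nth (taylor_fps (\<lambda>h. g (w h) $ i)) n =
       (\<Sum>j\<in>UNIV. fps_nth (taylor_fps (\<lambda>h. partial j g (w h) $ i) *
           fps_deriv (taylor_fps (\<lambda>h. w h $ j))) k) / real (Suc k)"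
      if w: "smooth_curve w" for w
    proof -
      have sm: "smooth_real (\<lambda>h. partial j g (w h) $ i)" "smooth_real (deriv (\<lambda>h. w h $ j))" for j
        using less.prems(1) w by (simp_all add: smooth_comp_partial smooth_real_deriv smooth_curveD)
      show ?thesis
        by (simp add: Suc taylor_fps_nth_Suc deriv_eqI[OF smooth_comp_has_derivative[OF less.prems(1) w]]
            taylor_fps_sum[OF smooth_real_mult[OF sm]] taylor_fps_mult[OF sm] fps_sum_nth fps_deriv_taylor_fps)
    qed
    \<comment> \<open>Coefficient \<open>m\<close> of the derivative of a curve involves coefficient
      \<open>m + 1\<close> of the curve, which is still covered since \<open>m \<le> k\<close> and
      \<open>n = Suc k\<close>.\<close>
    have "fps_nth (taylor_fps (\<lambda>h. partial j g (c h) $ i) *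
           fps_deriv (taylor_fps (\<lambda>h. c h $ j))) k = fps_nth (taylor_fps (\<lambda>h. partial j g (e h) $ i) *
           fps_deriv (taylor_fps (\<lambda>h. e h $ j))) k" for j
      by (rule fps_mult_nth_cong)
        (use less.prems(2) Suc in \<open>auto intro!: less.IH smooth_directional[OF less.prems(1)]\<close>)
    then show ?thesis
      by (simp add: * c e)
  qed
qed

section \<open>Symmetry of second derivatives and the quadratic remainder\<close>

text \<open>Two applications of the mean value theorem, first in direction \<open>u\<close>, then in
  direction \<open>w\<close>, turn the second difference into \<open>h ^ 2\<close> times the mixed
  derivative at a nearby point; continuity gives the limit. Components are used because the mean
  value theorem is a scalar statement.\<close>

lemma second_difference_tendsto:
  fixes g :: "real ^ 'd \<Rightarrow> real ^ 'd::finite"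
  assumes g: "smooth g"
  shows "((\<lambda>h. (g (x + h *\<^sub>R u + h *\<^sub>R w) $ i - g (x + h *\<^sub>R u) $ i - g (x + h *\<^sub>R w) $ i + g x $ i) / h\<^sup>2)
    \<longlongrightarrow> frechet_derivative (\<lambda>y. frechet_derivative g (at y) u) (at x) w $ i) (at_right 0)"
proof -
  define g1 where "g1 = (\<lambda>y. frechet_derivative g (at y) u)"
  define g2 where "g2 = (\<lambda>y. frechet_derivative g1 (at y) w)"
  define \<Delta> where "\<Delta> h = g (x + h *\<^sub>R u + h *\<^sub>R w) $ i - g (x + h *\<^sub>R u) $ i - g (x + h *\<^sub>R w) $ i + g x $ i" for h
  have g1: "smooth g1" and g2: "smooth g2"
    unfolding g1_def g2_def using g by (auto intro: smooth_directional)
  have line: "((\<lambda>t. k (y + t *\<^sub>R v) $ i) has_real_derivative frechet_derivative k (at (y + t *\<^sub>R v)) v $ i) (at t)"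
    if "smooth k" for k :: "real ^ 'd \<Rightarrow> real ^ 'd" and y v t
  proof -
    have "((\<lambda>t. y + t *\<^sub>R v) has_derivative (\<lambda>s. s *\<^sub>R v)) (at t)"
      by (auto intro!: derivative_eq_intros)
    from diff_chain_at[OF this smooth_has_derivative[OF that]]
    have "((\<lambda>t. k (y + t *\<^sub>R v) $ i) has_derivative
        (\<lambda>s. frechet_derivative k (at (y + t *\<^sub>R v)) (s *\<^sub>R v) $ i)) (at t)"
      by (auto simp: o_def intro: bounded_linear.has_derivative[OF bounded_linear_vec_nth])
    moreover have "linear (frechet_derivative k (at (y + t *\<^sub>R v)))"
      using that smooth_has_derivative has_derivative_linear by blast
    ultimately show ?thesis
      by (auto simp: has_field_derivative_def linear_cmul mult.commute elim!: has_derivative_eq_rhs)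
  qed
  have "\<exists>\<xi> \<eta>. 0 < \<xi> \<and> \<xi> < h \<and> 0 < \<eta> \<and> \<eta> < h \<and> \<Delta> h = h\<^sup>2 * g2 (x + \<xi> *\<^sub>R u + \<eta> *\<^sub>R w) $ i"
    if "0 < h" for h
  proof -
    \<comment> \<open>The difference in direction \<open>w\<close> at position \<open>t\<close>
      along \<open>u\<close>; its increment from \<open>0\<close> to \<open>h\<close> is the second
      difference.\<close>
    define p where "p t = g ((x + h *\<^sub>R w) + t *\<^sub>R u) $ i - g (x + t *\<^sub>R u) $ i" for t
    have "(p has_real_derivative g1 ((x + h *\<^sub>R w) + t *\<^sub>R u) $ i - g1 (x + t *\<^sub>R u) $ i) (at t)" for t
      unfolding p_def g1_def by (intro DERIV_diff line g)
    from MVT2[OF that this] obtain \<xi> where \<xi>: "0 < \<xi>" "\<xi> < h"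
      and 1: "p h - p 0 = h * (g1 ((x + h *\<^sub>R w) + \<xi> *\<^sub>R u) $ i - g1 (x + \<xi> *\<^sub>R u) $ i)"
      by auto
    from MVT2[OF that line[OF g1, of "x + \<xi> *\<^sub>R u" w]] obtain \<eta> where \<eta>: "0 < \<eta>" "\<eta> < h"
      and 2: "g1 (x + \<xi> *\<^sub>R u + h *\<^sub>R w) $ i - g1 (x + \<xi> *\<^sub>R u) $ i = h * g2 (x + \<xi> *\<^sub>R u + \<eta> *\<^sub>R w) $ i"
      by (auto simp: g2_def)
    have "\<Delta> h = p h - p 0"
      by (simp add: \<Delta>_def p_def algebra_simps)
    also have "\<dots> = h\<^sup>2 * g2 (x + \<xi> *\<^sub>R u + \<eta> *\<^sub>R w) $ i"
      using 1 2 by (simp add: add_ac power2_eq_square)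
    finally show ?thesis using \<xi> \<eta> by blast
  qed
  then obtain \<xi> \<eta> where *: "\<And>h. 0 < h \<Longrightarrow> 0 < \<xi> h \<and> \<xi> h < h \<and> 0 < \<eta> h \<and> \<eta> h < h \<and>
      \<Delta> h = h\<^sup>2 * g2 (x + \<xi> h *\<^sub>R u + \<eta> h *\<^sub>R w) $ i"
    by metis
  have pos: "eventually (\<lambda>h::real. 0 < h) (at_right 0)"
    by (rule eventually_at_right_less)
  have id: "((\<lambda>h::real. h) \<longlongrightarrow> 0) (at_right 0)"
    by (rule tendsto_ident_at)
  have \<xi>: "(\<xi> \<longlongrightarrow> 0) (at_right 0)"
    by (rule tendsto_sandwich[OF _ _ tendsto_const id]; rule eventually_mono[OF pos])
      (use * in \<open>auto intro: less_imp_le\<close>)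
  have \<eta>: "(\<eta> \<longlongrightarrow> 0) (at_right 0)"
    by (rule tendsto_sandwich[OF _ _ tendsto_const id]; rule eventually_mono[OF pos])
      (use * in \<open>auto intro: less_imp_le\<close>)
  have "((\<lambda>h. x + \<xi> h *\<^sub>R u + \<eta> h *\<^sub>R w) \<longlongrightarrow> x + 0 *\<^sub>R u + 0 *\<^sub>R w) (at_right 0)"
    by (intro tendsto_intros \<xi> \<eta>)
  moreover have "isCont g2 x"
    using smooth_continuous[OF g2] by (simp add: continuous_on_eq_continuous_at)
  ultimately have "((\<lambda>h. g2 (x + \<xi> h *\<^sub>R u + \<eta> h *\<^sub>R w) $ i) \<longlongrightarrow> g2 x $ i) (at_right 0)"
    by (auto intro!: tendsto_vec_nth isCont_tendsto_compose[of _ g2])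
  moreover have "eventually (\<lambda>h. g2 (x + \<xi> h *\<^sub>R u + \<eta> h *\<^sub>R w) $ i = \<Delta> h / h\<^sup>2) (at_right 0)"
    by (rule eventually_mono[OF pos]) (use * in auto)
  ultimately have "((\<lambda>h. \<Delta> h / h\<^sup>2) \<longlongrightarrow> g2 x $ i) (at_right 0)"
    by (rule Lim_transform_eventually)
  then show ?thesis
    by (simp add: \<Delta>_def g1_def g2_def)
qed

text \<open>The second difference quotient is symmetric in \<open>u\<close> and \<open>w\<close>,
  and its limit is unique.\<close>

lemma frechet_derivative_commute:
  fixes g :: "real ^ 'd \<Rightarrow> real ^ 'd::finite"
  assumes "smooth g"
  shows "frechet_derivative (\<lambda>y. frechet_derivative g (at y) u) (at x) w =
         frechet_derivative (\<lambda>y. frechet_derivative g (at y) w) (at x) u"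
proof (rule vec_eq_iff[THEN iffD2], rule allI)
  fix i
  show "frechet_derivative (\<lambda>y. frechet_derivative g (at y) u) (at x) w $ i =
         frechet_derivative (\<lambda>y. frechet_derivative g (at y) w) (at x) u $ i"
    using second_difference_tendsto[OF assms, of x w u i]
    by (intro tendsto_unique[OF trivial_limit_at_right_real second_difference_tendsto[OF assms]])
      (simp add: algebra_simps)
qed

section \<open>The first-order Taylor remainder between two curves\<close>

definition remainder ::
    "(real ^ 'd \<Rightarrow> real ^ 'd) \<Rightarrow> (real \<Rightarrow> real ^ 'd) \<Rightarrow> (real \<Rightarrow> real ^ 'd) \<Rightarrow> 'd::finite \<Rightarrow> real \<Rightarrow> real" where
  "remainder g c e i h =
     g (c h) $ i - g (e h) $ i - (\<Sum>j\<in>UNIV. partial j g (e h) $ i * (c h $ j - e h $ j))"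

lemma smooth_remainder:
  "smooth g \<Longrightarrow> smooth_curve c \<Longrightarrow> smooth_curve e \<Longrightarrow> smooth_real (remainder g c e i)"
  unfolding remainder_def[abs_def]
  by (intro smooth_real_intros smooth_comp smooth_directional smooth_curveD)

text \<open>The form is chosen for induction: the first sum contains remainders of the partial
  derivatives, the second contains products of two factors that are both small when the curves agree
  to some order.\<close>

lemma deriv_remainder:
  fixes g :: "real ^ 'd \<Rightarrow> real ^ 'd::finite"
  assumes g: "smooth g" and c: "smooth_curve c" and e: "smooth_curve e"
  shows "deriv (remainder g c e i) = (\<lambda>h.
     (\<Sum>j\<in>UNIV. remainder (partial j g) c e i h * deriv (\<lambda>h. e h $ j) h) +
     (\<Sum>j\<in>UNIV. (partial j g (c h) $ i - partial j g (e h) $ i) *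
        (deriv (\<lambda>h. c h $ j) h - deriv (\<lambda>h. e h $ j) h)))"
proof (rule deriv_eqI)
  fix h
  let ?c = "\<lambda>j. deriv (\<lambda>h. c h $ j) h" and ?e = "\<lambda>j. deriv (\<lambda>h. e h $ j) h"
  let ?H = "\<lambda>j k. partial k (partial j g) (e h) $ i"
  \<comment> \<open>Symmetry of second derivatives converts the terms from differentiating the
    linear part into the linear parts of the remainders of \<open>partial j g\<close>.\<close>
  have swap: "(\<Sum>j\<in>UNIV. (\<Sum>k\<in>UNIV. ?H j k * ?e k) * (c h $ j - e h $ j)) =
      (\<Sum>j\<in>UNIV. (\<Sum>k\<in>UNIV. ?H j k * (c h $ k - e h $ k)) * ?e j)"
    unfolding sum_distrib_right
    by (subst sum.swap) (simp add: frechet_derivative_commute[OF g] mult_ac)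
  have "(remainder g c e i has_real_derivative
      (\<Sum>j\<in>UNIV. partial j g (c h) $ i * ?c j) - (\<Sum>j\<in>UNIV. partial j g (e h) $ i * ?e j) -
      (\<Sum>j\<in>UNIV. (\<Sum>k\<in>UNIV. ?H j k * ?e k) * (c h $ j - e h $ j) +
        (?c j - ?e j) * partial j g (e h) $ i)) (at h)"
    unfolding remainder_def[abs_def]
    by (intro DERIV_diff DERIV_sum DERIV_mult smooth_comp_has_derivative smooth_directional
        smooth_real_has_derivative smooth_curveD g c e)
  then show "(remainder g c e i has_real_derivative
      (\<Sum>j\<in>UNIV. remainder (partial j g) c e i h * ?e j) +
     (\<Sum>j\<in>UNIV. (partial j g (c h) $ i - partial j g (e h) $ i) * (?c j - ?e j))) (at h)"
    by (rule DERIV_cong)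
      (use swap in \<open>simp add: remainder_def sum.distrib sum_subtractf algebra_simps\<close>)
qed

lemma fps_mult_nth_eq_0:
  fixes A B :: "'a::semiring_0 fps"
  assumes "\<And>m. m < p \<Longrightarrow> fps_nth A m = 0" "\<And>m. m < q \<Longrightarrow> fps_nth B m = 0" "n < p + q"
  shows "fps_nth (A * B) n = 0"
  unfolding fps_mult_nth
proof (intro sum.neutral ballI)
  fix m assume "m \<in> {0..n}"
  then show "fps_nth A m * fps_nth B (n - m) = 0"
    using assms by (cases "m < p") auto
qed

text \<open>Curves that agree modulo \<open>h ^ p\<close> leave a remainder
  \<open>O(h ^ (2 * p))\<close>. The constant term vanishes because the curves start at the same
  point; higher coefficients come from \<open>deriv_remainder\<close>.\<close>

lemma taylor_fps_remainder:
  fixes g :: "real ^ 'd \<Rightarrow> real ^ 'd::finite"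
  assumes "smooth g" and c: "smooth_curve c" and e: "smooth_curve e"
    and eq: "\<And>m d. m < p \<Longrightarrow>
      fps_nth (taylor_fps (\<lambda>h. c h $ d)) m = fps_nth (taylor_fps (\<lambda>h. e h $ d)) m"
    and "n < 2 * p"
  shows "fps_nth (taylor_fps (remainder g c e i)) n = 0"
  using assms(1,5)
proof (induction n arbitrary: g rule: less_induct)
  case (less n)
  note g = less.prems(1)
  show ?case
  proof (cases n)
    case 0
    then have "c 0 = e 0"
      using less.prems(2) eq[of 0] by (simp add: vec_eq_iff)
    with 0 show ?thesis by (simp add: remainder_def)
  next
    case (Suc k)
    let ?r = "\<lambda>j. remainder (partial j g) c e i" and ?e = "\<lambda>j. deriv (\<lambda>h. e h $ j)"
    let ?d = "\<lambda>j h. partial j g (c h) $ i - partial j g (e h) $ i"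
    let ?s = "\<lambda>j h. deriv (\<lambda>h. c h $ j) h - deriv (\<lambda>h. e h $ j) h"
    have sm: "smooth_real (?r j)" "smooth_real (?e j)" "smooth_real (?d j)" "smooth_real (?s j)" for j
      by (intro smooth_remainder smooth_directional smooth_real_diff smooth_real_deriv
          smooth_comp_partial smooth_curveD[OF c] smooth_curveD[OF e] g c e)+
    \<comment> \<open>Here the remainder alone supplies the vanishing: the induction hypothesis
      covers every order below \<open>n = Suc k\<close>.\<close>
    have "fps_nth (taylor_fps (?r j) * taylor_fps (?e j)) k = 0" for j
      by (rule fps_mult_nth_eq_0[of "Suc k" _ 0])
        (use less.prems(2) Suc in \<open>auto intro!: less.IH smooth_directional[OF g]\<close>)
    \<comment> \<open>Differentiating the curves costs one order, so the product vanishes below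
      order \<open>p + (p - 1)\<close>; this suffices as \<open>k + 1 < 2 * p\<close>.\<close>
    moreover have "fps_nth (taylor_fps (?d j) * taylor_fps (?s j)) k = 0" for j
    proof (rule fps_mult_nth_eq_0[of p _ "p - 1"])
      fix m assume "m < p"
      then show "fps_nth (taylor_fps (?d j)) m = 0"
        using taylor_fps_comp_cong[OF smooth_directional[OF g] c e, of m] eq
        by (simp add: taylor_fps_diff smooth_comp_partial g c e)
    next
      fix m assume "m < p - 1"
      with eq[of "Suc m" j] show "fps_nth (taylor_fps (?s j)) m = 0"
        by (simp add: taylor_fps_diff smooth_real_deriv smooth_curveD c e taylor_fps_nth_Suc del: of_nat_Suc)
    qed (use less.prems Suc in auto)
    moreover have "taylor_fps (deriv (remainder g c e i)) =
        (\<Sum>j\<in>UNIV. taylor_fps (?r j) * taylor_fps (?e j)) + (\<Sum>j\<in>UNIV. taylor_fps (?d j) * taylor_fps (?s j))"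
      unfolding deriv_remainder[OF g c e]
      by (simp add: taylor_fps_add[OF smooth_real_sum smooth_real_sum] taylor_fps_sum
          smooth_real_mult[OF sm(1,2)] smooth_real_mult[OF sm(3,4)]
          taylor_fps_mult[OF sm(1,2)] taylor_fps_mult[OF sm(3,4)])
    ultimately show ?thesis
      by (simp add: Suc taylor_fps_nth_Suc fps_sum_nth)
  qed
qed

section \<open>Formal substitution\<close>

text \<open>The contribution of a single field to \<open>formal_eval\<close>, as a power series.
  Truncation at the order of the coefficient turns the formal curve into a polynomial one.\<close>

definition comp_series :: "(real ^ 'd \<Rightarrow> real ^ 'd) \<Rightarrow> 'd formal_curve \<Rightarrow> 'd::finite \<Rightarrow> real fps" where
  "comp_series g v i = Abs_fps (\<lambda>n. fps_nth (taylor_fps (\<lambda>h. g (truncated_curve n v h) $ i)) n)"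

lemma smooth_curve_truncated: "smooth_curve (truncated_curve n v)"
  by (simp add: smooth_curve_def smooth_truncated_curve)

text \<open>Truncations at \<open>m\<close> and at \<open>n\<close> agree up to order
  \<open>m\<close>. Hence one genuine curve serves for all coefficients up to \<open>n\<close>, as
  products of series require.\<close>

lemma comp_series_nth:
  fixes g :: "real ^ 'd \<Rightarrow> real ^ 'd::finite"
  assumes "smooth g" "m \<le> n"
  shows "fps_nth (comp_series g v i) m = fps_nth (taylor_fps (\<lambda>h. g (truncated_curve n v h) $ i)) m"
  unfolding comp_series_def
  by (simp, rule taylor_fps_comp_cong[OF assms(1) smooth_curve_truncated smooth_curve_truncated])
    (use assms(2) in \<open>simp add: taylor_fps_truncated_curve\<close>)

lemma truncated_curve_at_0: "truncated_curve n v 0 $ d = fps_nth (v $ d) 0"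
  by (simp add: truncated_curve_def power_0_left if_distrib[of "\<lambda>x. _ * x"] cong: if_cong)

lemma comp_series_nth_0: "fps_nth (comp_series g v i) 0 = g (\<chi> d. fps_nth (v $ d) 0) $ i"
proof -
  have "truncated_curve 0 v 0 = (\<chi> d. fps_nth (v $ d) 0)"
    by (simp add: vec_eq_iff truncated_curve_at_0)
  then show ?thesis by (simp add: comp_series_def)
qed

text \<open>Fields with index above \<open>n\<close> are shifted beyond order \<open>n\<close> by
  their factor \<open>h ^ k\<close>, so the summation bound can be chosen uniformly for all
  coefficients up to \<open>N\<close>.\<close>

lemma formal_eval_nth:
  fixes F :: "'d::finite formal_field"
  assumes "\<And>k. smooth (F k)" "n \<le> N"
  shows "fps_nth (formal_eval F v $ i) n = fps_nth (\<Sum>k\<le>N. fps_X ^ k * comp_series (F k) v i) n"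
proof -
  have sm: "smooth_real (\<lambda>h. F k (truncated_curve n v h) $ i)" for k
    by (rule smooth_comp[OF assms(1) smooth_curve_truncated])
  have "fps_nth (formal_eval F v $ i) n =
      fps_nth (\<Sum>k\<le>n. fps_X ^ k * taylor_fps (\<lambda>h. F k (truncated_curve n v h) $ i)) n"
    by (simp add: formal_eval_def taylor_series_nth taylor_fps_sum[OF smooth_real_mult[OF smooth_real_power sm]]
        taylor_fps_mult[OF smooth_real_power sm] taylor_fps_power)
  also have "\<dots> = fps_nth (\<Sum>k\<le>n. fps_X ^ k * comp_series (F k) v i) n"
    by (simp add: fps_sum_nth fps_X_power_mult_nth comp_series_nth[OF assms(1), of _ n])
  also have "\<dots> = fps_nth (\<Sum>k\<le>N. fps_X ^ k * comp_series (F k) v i) n"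
    unfolding fps_sum_nth
    by (rule sum.mono_neutral_left) (use assms(2) in \<open>auto simp: fps_X_power_mult_nth\<close>)
  finally show ?thesis .
qed

lemma formal_eval_nth_cong:
  fixes F F' :: "'d::finite formal_field"
  assumes "\<And>k. k \<le> n \<Longrightarrow> F k = F' k"
    and "\<And>m d. m \<le> n \<Longrightarrow> fps_nth (v $ d) m = fps_nth (w $ d) m"
  shows "fps_nth (formal_eval F v $ i) n = fps_nth (formal_eval F' w $ i) n"
proof -
  have "truncated_curve n v = truncated_curve n w"
    using assms(2) by (simp add: truncated_curve_def fun_eq_iff)
  with assms(1) show ?thesis by (simp add: formal_eval_def)
qed

text \<open>Field \<open>n\<close> carries the factor \<open>h ^ n\<close> and so enters coefficient
  \<open>n\<close> only through its value at the constant term of the curve; the lower fields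
  cancel.\<close>

lemma formal_eval_nth_diff:
  fixes F F' :: "'d::finite formal_field"
  assumes "\<And>k. smooth (F k)" "\<And>k. smooth (F' k)" "\<And>k. k < n \<Longrightarrow> F k = F' k"
  shows "fps_nth (formal_eval F v $ i) n - fps_nth (formal_eval F' v $ i) n =
     (F n (\<chi> d. fps_nth (v $ d) 0) - F' n (\<chi> d. fps_nth (v $ d) 0)) $ i"
proof -
  have *: "{..n} = insert n {..<n}" by auto
  show ?thesis
    by (simp add: formal_eval_nth[OF assms(1) order_refl] formal_eval_nth[OF assms(2) order_refl]
        * fps_sum_nth assms(3) fps_X_power_mult_nth comp_series_nth_0)
qed

text \<open>Carries the vanishing of the Taylor remainder over from smooth curves to formal
  ones.\<close>

lemma comp_series_linearization:
  fixes g :: "real ^ 'd \<Rightarrow> real ^ 'd::finite"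
  assumes g: "smooth g"
    and eq: "\<And>m d. m < p \<Longrightarrow> fps_nth (v $ d) m = fps_nth (w $ d) m"
    and "n < 2 * p"
  shows "fps_nth (comp_series g v i) n =
     fps_nth (comp_series g w i + (\<Sum>j\<in>UNIV. comp_series (partial j g) w i * (v $ j - w $ j))) n"
proof -
  \<comment> \<open>Truncation at \<open>2 * p\<close> preserves every coefficient that occurs,
    since \<open>n < 2 * p\<close>.\<close>
  let ?v = "truncated_curve (2 * p) v" and ?w = "truncated_curve (2 * p) w"
  let ?D = "\<lambda>j h. partial j g (?w h) $ i"
  have sm: "smooth_real (\<lambda>h. g (?v h) $ i)" "smooth_real (\<lambda>h. g (?w h) $ i)"
    "smooth_real (?D j)" "smooth_real (\<lambda>h. ?v h $ j - ?w h $ j)" for j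
    by (intro smooth_comp smooth_comp_partial smooth_real_diff smooth_curveD
        smooth_curve_truncated g)+
  have "taylor_fps (remainder g ?v ?w i) = taylor_fps (\<lambda>h. g (?v h) $ i) - taylor_fps (\<lambda>h. g (?w h) $ i)
      - (\<Sum>j\<in>UNIV. taylor_fps (?D j) * taylor_fps (\<lambda>h. ?v h $ j - ?w h $ j))"
    unfolding remainder_def[abs_def]
    by (simp add: taylor_fps_diff[OF smooth_real_diff[OF sm(1,2)] smooth_real_sum[OF smooth_real_mult[OF sm(3,4)]]]
        taylor_fps_diff[OF sm(1,2)] taylor_fps_sum[OF smooth_real_mult[OF sm(3,4)]] taylor_fps_mult[OF sm(3,4)])
  moreover have "fps_nth (taylor_fps (remainder g ?v ?w i)) n = 0"
    by (rule taylor_fps_remainder[OF g smooth_curve_truncated smooth_curve_truncated _ assms(3)])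
      (simp add: taylor_fps_truncated_curve eq)
  moreover have "fps_nth (taylor_fps (?D j) * taylor_fps (\<lambda>h. ?v h $ j - ?w h $ j)) n =
      fps_nth (comp_series (partial j g) w i * (v $ j - w $ j)) n" for j
  proof (rule fps_mult_nth_cong)
    fix m assume "m \<le> n"
    with assms(3) show "fps_nth (taylor_fps (?D j)) m = fps_nth (comp_series (partial j g) w i) m"
      using comp_series_nth[OF smooth_directional[OF g], of m "2 * p"] by simp
    show "fps_nth (taylor_fps (\<lambda>h. ?v h $ j - ?w h $ j)) m = fps_nth (v $ j - w $ j) m"
      using \<open>m \<le> n\<close> assms(3)
      by (simp add: taylor_fps_diff smooth_truncated_curve taylor_fps_truncated_curve)
  qed
  ultimately show ?thesis
    using assms(3) by (simp add: fps_sum_nth comp_series_nth[OF g, of n "2 * p"])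
qed

text \<open>The linearization is applied to each field \<open>F k\<close> at order
  \<open>n - k\<close>, which is still below \<open>2 * p\<close>; exchanging the sums collects the
  linear terms into the formal Jacobian.\<close>

lemma formal_eval_linearization:
  fixes F :: "'d::finite formal_field"
  assumes F: "\<And>k. smooth (F k)"
    and eq: "\<And>m d. m < p \<Longrightarrow> fps_nth (v $ d) m = fps_nth (w $ d) m"
    and n: "n < 2 * p"
  shows "fps_nth (formal_eval F v $ i) n =
    fps_nth ((formal_eval F w + formal_jacobian F w *v (v - w)) $ i) n"
proof -
  let ?D = "\<lambda>j k. comp_series (partial j (F k)) w i" and ?\<delta> = "\<lambda>j. v $ j - w $ j"
  have "fps_nth (formal_eval F v $ i) n = (\<Sum>k\<le>n. fps_nth (fps_X ^ k * comp_series (F k) v i) n)"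
    by (simp add: formal_eval_nth[OF F order_refl] fps_sum_nth)
  also have "\<dots> = (\<Sum>k\<le>n. fps_nth (fps_X ^ k * (comp_series (F k) w i + (\<Sum>j\<in>UNIV. ?D j k * ?\<delta> j))) n)"
    using n by (intro sum.cong refl) (simp add: fps_X_power_mult_nth comp_series_linearization[OF F eq])
  also have "\<dots> = fps_nth (\<Sum>k\<le>n. fps_X ^ k * comp_series (F k) w i) n +
      fps_nth (\<Sum>k\<le>n. \<Sum>j\<in>UNIV. (fps_X ^ k * ?D j k) * ?\<delta> j) n"
    by (simp add: fps_sum_nth distrib_left sum.distrib sum_distrib_left mult.assoc)
  also have "(\<Sum>k\<le>n. \<Sum>j\<in>UNIV. (fps_X ^ k * ?D j k) * ?\<delta> j) =
      (\<Sum>j\<in>UNIV. (\<Sum>k\<le>n. fps_X ^ k * ?D j k) * ?\<delta> j)"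
    by (subst sum.swap) (simp add: sum_distrib_right)
  also have "fps_nth \<dots> n = (\<Sum>j\<in>UNIV. fps_nth (formal_jacobian F w $ i $ j * ?\<delta> j) n)"
    unfolding fps_sum_nth
  proof (intro sum.cong refl fps_mult_nth_cong)
    fix j m assume "m \<le> n"
    then show "fps_nth (\<Sum>k\<le>n. fps_X ^ k * ?D j k) m = fps_nth (formal_jacobian F w $ i $ j) m"
      using formal_eval_nth[OF smooth_directional[OF F], of m n] by (simp add: formal_jacobian_def)
  qed
  finally show ?thesis
    by (simp add: formal_eval_nth[OF F order_refl] fps_sum_nth matrix_vector_mult_def)
qed

section \<open>Convergence order of the iterations\<close>

text \<open>The formal reading of \<open>v - w = O(h ^ p)\<close>.\<close>

definition curves_agree :: "nat \<Rightarrow> 'd formal_curve \<Rightarrow> 'd::finite formal_curve \<Rightarrow> bool" where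
  "curves_agree p v w \<longleftrightarrow> (\<forall>m<p. \<forall>d. fps_nth (v $ d) m = fps_nth (w $ d) m)"

lemma curves_agreeD: "curves_agree p v w \<Longrightarrow> m < p \<Longrightarrow> fps_nth (v $ d) m = fps_nth (w $ d) m"
  by (simp add: curves_agree_def)

lemma curves_agree_mono: "curves_agree q v w \<Longrightarrow> p \<le> q \<Longrightarrow> curves_agree p v w"
  by (simp add: curves_agree_def)

text \<open>The factor \<open>h\<close> shifts the index by one, the source of the extra order in
  every step. With \<open>u\<close> arbitrary, this covers the stage equations, both iterations and
  the output.\<close>

lemma stage_nth:
  "fps_nth ((const_curve x + fps_X *s (\<Sum>j=1..s. fps_const (c j) *s u j)) $ d) n =
     (case n of 0 \<Rightarrow> x $ d | Suc m \<Rightarrow> \<Sum>j=1..s. c j * fps_nth (u j $ d) m)"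
  by (cases n) (simp_all add: const_curve_def fps_sum_nth)

text \<open>Substitution preserves the order of agreement and the factor \<open>h\<close> adds one.
  The cap \<open>q\<close> is the order to which \<open>v\<close> solves the stage
  equations.\<close>

lemma fixed_point_step_order:
  fixes F :: "'d::finite formal_field"
  assumes v: "\<And>i. i \<in> {1..s} \<Longrightarrow> curves_agree q (v i)
      (const_curve x + fps_X *s (\<Sum>j=1..s. fps_const (a i j) *s formal_eval F (v j)))"
    and step: "iteration_step Fixed_Point s a F x u w"
    and u: "\<And>i. i \<in> {1..s} \<Longrightarrow> curves_agree p (u i) (v i)"
    and i: "i \<in> {1..s}"
  shows "curves_agree (min (Suc p) q) (w i) (v i)"
  unfolding curves_agree_def
proof (intro allI impI)
  fix m d assume m: "m < min (Suc p) q"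
  have *: "fps_nth (formal_eval F (u j) $ d) k = fps_nth (formal_eval F (v j) $ d) k"
    if "j \<in> {1..s}" "m = Suc k" for j k
    by (rule formal_eval_nth_cong) (use curves_agreeD[OF u[OF that(1)]] m that(2) in auto)
  then show "fps_nth (w i $ d) m = fps_nth (v i $ d) m"
  proof -
    have "w i = const_curve x + fps_X *s (\<Sum>j=1..s. fps_const (a i j) *s formal_eval F (u j))"
      using step i by simp
    moreover have "fps_nth (v i $ d) m = fps_nth ((const_curve x +
        fps_X *s (\<Sum>j=1..s. fps_const (a i j) *s formal_eval F (v j))) $ d) m"
      using curves_agreeD[OF v[OF i]] m by simp
    ultimately show ?thesis
      using * by (simp only: stage_nth) (cases m; simp)
  qed
qed

text \<open>Linearizing at \<open>u\<close> reproduces \<open>formal_eval F (v j)\<close> below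
  order \<open>2 * p\<close>, and the factor \<open>h\<close> adds one.\<close>

lemma newton_raphson_step_order:
  fixes F :: "'d::finite formal_field"
  assumes F: "\<And>k. smooth (F k)"
    and v: "\<And>i. i \<in> {1..s} \<Longrightarrow> curves_agree q (v i)
      (const_curve x + fps_X *s (\<Sum>j=1..s. fps_const (a i j) *s formal_eval F (v j)))"
    and step: "iteration_step Newton_Raphson s a F x u w"
    and u: "\<And>i. i \<in> {1..s} \<Longrightarrow> curves_agree p (u i) (v i)"
    and i: "i \<in> {1..s}"
  shows "curves_agree (min (Suc (2 * p)) q) (w i) (v i)"
proof -
  \<comment> \<open>The unknown \<open>w\<close> stands on both sides of the linear system, but
    coefficient \<open>m\<close> on the left needs only lower ones on the right. This calls for an
    inner induction on \<open>m\<close>, over all stages at once.\<close>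
  have "fps_nth (w i $ d) m = fps_nth (v i $ d) m" if "m < min (Suc (2 * p)) q" "i \<in> {1..s}" for m d i
    using that
  proof (induction m arbitrary: d i rule: less_induct)
    case (less m)
    show ?case
    proof (cases m)
      case 0
      then show ?thesis
        using less.prems step curves_agreeD[OF v[OF less.prems(2)], of m d] by (simp add: stage_nth)
    next
      case (Suc k)
      have *: "fps_nth ((formal_eval F (u j) + formal_jacobian F (u j) *v (w j - u j)) $ d) k =
          fps_nth (formal_eval F (v j) $ d) k" if j: "j \<in> {1..s}" for j
      proof -
        \<comment> \<open>By the inner induction, \<open>w j\<close> may be replaced by
          \<open>v j\<close> in the linear term up to order \<open>k\<close>.\<close>
        have "fps_nth (formal_jacobian F (u j) $ d $ l * (w j - u j) $ l) k =
            fps_nth (formal_jacobian F (u j) $ d $ l * (v j - u j) $ l) k" for l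
          by (rule fps_mult_nth_cong) (use less Suc j in auto)
        moreover have "fps_nth (formal_eval F (v j) $ d) k =
            fps_nth ((formal_eval F (u j) + formal_jacobian F (u j) *v (v j - u j)) $ d) k"
          using curves_agreeD[OF u[OF j]] less.prems(1) Suc
          by (intro formal_eval_linearization[OF F, where p = p]) auto
        ultimately show ?thesis
          by (simp add: matrix_vector_mult_def fps_sum_nth)
      qed
      have "w i = const_curve x + fps_X *s (\<Sum>j=1..s. fps_const (a i j) *s
          (formal_eval F (u j) + formal_jacobian F (u j) *v (w j - u j)))"
        using step less.prems(2) by simp
      from arg_cong[OF this, of "\<lambda>c. fps_nth (c $ d) m"]
      have "fps_nth (w i $ d) m = (\<Sum>j=1..s. a i j *
          fps_nth ((formal_eval F (u j) + formal_jacobian F (u j) *v (w j - u j)) $ d) k)"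
        by (simp only: stage_nth Suc nat.case)
      also have "\<dots> = (\<Sum>j=1..s. a i j * fps_nth (formal_eval F (v j) $ d) k)"
        by (intro sum.cong refl) (simp only: *)
      also have "\<dots> = fps_nth (v i $ d) m"
        using curves_agreeD[OF v[OF less.prems(2)], of m d] less.prems(1) Suc
        by (simp only: stage_nth nat.case min_less_iff_conj)
      finally show ?thesis .
    qed
  qed
  with i show ?thesis by (simp add: curves_agree_def)
qed

text \<open>Closed forms of the recursions \<open>p \<mapsto> p + 1\<close> and
  \<open>p \<mapsto> 2 * p + 1\<close> started at \<open>1\<close>.\<close>

fun stage_order :: "iteration \<Rightarrow> nat \<Rightarrow> nat" where
  "stage_order Fixed_Point l = l + 1"
| "stage_order Newton_Raphson l = 2 ^ (l + 1) - 1"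

lemma unrolled_stages_order:
  fixes F :: "'d::finite formal_field"
  assumes F: "\<And>k. smooth (F k)"
    and v: "\<And>i. i \<in> {1..s} \<Longrightarrow> curves_agree q (v i)
      (const_curve x + fps_X *s (\<Sum>j=1..s. fps_const (a i j) *s formal_eval F (v j)))"
    and u0: "\<forall>i\<in>{1..s}. u 0 i = const_curve x"
    and step: "\<forall>l\<in>{1..L}. iteration_step M s a F x (u (l - 1)) (u l)"
    and "l \<le> L" "i \<in> {1..s}"
  shows "curves_agree (min (stage_order M l) q) (u l i) (v i)"
  using assms(5,6)
proof (induction l arbitrary: i)
  case 0
  \<comment> \<open>The initial stages have the correct constant term \<open>x\<close>, whence order
    1 within the cap \<open>q\<close>.\<close>
  have "stage_order M 0 = 1" by (cases M) auto
  then show ?case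
    using curves_agreeD[OF v[OF 0(2)], of 0] u0 0(2)
    by (auto simp: curves_agree_def stage_nth const_curve_def)
next
  case (Suc l)
  have st: "iteration_step M s a F x (u l) (u (Suc l))"
    using step Suc.prems(1) by (metis Suc_le_eq atLeastAtMost_iff diff_Suc_1 le_add1 plus_1_eq_Suc)
  have IH: "curves_agree (min (stage_order M l) q) (u l j) (v j)" if "j \<in> {1..s}" for j
    using Suc that by simp
  show ?case
  proof (cases M)
    case Fixed_Point
    show ?thesis
      by (rule curves_agree_mono[OF fixed_point_step_order[OF v st[unfolded Fixed_Point] IH Suc.prems(2)]])
        (auto simp: Fixed_Point)
  next
    case Newton_Raphson
    have "stage_order M (Suc l) = Suc (2 * stage_order M l)"
    proof -
      \<comment> \<open>Writing the power as a successor resolves the truncated subtraction in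
        \<open>stage_order\<close>.\<close>
      obtain n where "(2::nat) ^ l = Suc n"
        using not0_implies_Suc[of "2 ^ l"] by auto
      then show ?thesis by (simp add: Newton_Raphson)
    qed
    then show ?thesis
      by (intro curves_agree_mono[OF newton_raphson_step_order[OF F v st[unfolded Newton_Raphson] IH Suc.prems(2)]])
        auto
  qed
qed

section \<open>Comparison of the two IMDEs order by order\<close>

theorem theorem3p3:
  fixes f :: "real ^ 'd \<Rightarrow> real ^ 'd"
    and \<phi> :: "real \<Rightarrow> real ^ 'd \<Rightarrow> real ^ 'd"
    and s L :: nat
    and a :: "nat \<Rightarrow> nat \<Rightarrow> real" and b :: "nat \<Rightarrow> real"
    and M :: iteration
    and f_hat f_unr :: "nat \<Rightarrow> real ^ 'd \<Rightarrow> real ^ 'd"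
  assumes "smooth f"
    and "local_flow f \<phi>"
    and "rk_consistent s b"
    and "rk_implicit s a"
    and "is_IMDE (rk_scheme s a b) \<phi> f_hat"
    and "is_IMDE (unrolled_scheme M L s a b) \<phi> f_unr"
  shows "\<forall>k \<le> (case M of Fixed_Point \<Rightarrow> L | Newton_Raphson \<Rightarrow> 2 ^ (L + 1) - 2). f_hat k = f_unr k"
proof (intro allI impI)
  fix k assume "k \<le> (case M of Fixed_Point \<Rightarrow> L | Newton_Raphson \<Rightarrow> 2 ^ (L + 1) - 2)"
  \<comment> \<open>The bound on \<open>k\<close> is \<open>stage_order M L - 1\<close> for both
    iterations.\<close>
  then have "k < stage_order M L"
  proof (cases M)
    case Newton_Raphson
    obtain n where "(2::nat) ^ L = Suc n"
      using not0_implies_Suc[of "2 ^ L"] by auto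
    with \<open>k \<le> _\<close> Newton_Raphson show ?thesis by simp
  qed simp
  then show "f_hat k = f_unr k"
  proof (induction k rule: less_induct)
    case (less k)
    have eq: "f_hat j = f_unr j" if "j < k" for j
      using less that by simp
    have sm: "smooth (f_hat j)" "smooth (f_unr j)" for j
      using assms(5,6) by (auto simp: is_IMDE_def)
    show ?case
    proof (rule ext)
      fix x
      obtain v where v: "\<And>i. i \<in> {1..s} \<Longrightarrow> v i = const_curve x +
            fps_X *s (\<Sum>j=1..s. fps_const (a i j) *s formal_eval f_hat (v j))"
        and P_hat: "taylor_series (\<lambda>t. \<phi> t x) = rk_output s b f_hat x v"
        using assms(5) unfolding is_IMDE_def rk_scheme_def by blast
      obtain u where u0: "\<forall>i\<in>{1..s}. u 0 i = const_curve x"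
        and step: "\<forall>l\<in>{1..L}. iteration_step M s a f_unr x (u (l - 1)) (u l)"
        and P_unr: "taylor_series (\<lambda>t. \<phi> t x) = rk_output s b f_unr x (u L)"
        using assms(6) unfolding is_IMDE_def unrolled_scheme_def by blast
      \<comment> \<open>Coefficient \<open>m \<le> k\<close> of a stage reads only fields of index
        below \<open>m\<close>, where \<open>f_hat\<close> and \<open>f_unr\<close> agree by
        induction.\<close>
      have "curves_agree (Suc k) (v i)
          (const_curve x + fps_X *s (\<Sum>j=1..s. fps_const (a i j) *s formal_eval f_unr (v j)))"
        if "i \<in> {1..s}" for i
        unfolding curves_agree_def
      proof (intro allI impI)
        fix m d assume m: "m < Suc k"
        have "fps_nth (formal_eval f_hat (v j) $ d) n = fps_nth (formal_eval f_unr (v j) $ d) n"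
          if "m = Suc n" for j n
          by (rule formal_eval_nth_cong) (use m that eq in auto)
        then show "fps_nth (v i $ d) m = fps_nth ((const_curve x +
            fps_X *s (\<Sum>j=1..s. fps_const (a i j) *s formal_eval f_unr (v j))) $ d) m"
          by (subst v[OF that], simp only: stage_nth) (cases m; simp)
      qed
      \<comment> \<open>Since \<open>Suc k \<le> stage_order M L\<close>, the minimum is the cap
        \<open>Suc k\<close>.\<close>
      from unrolled_stages_order[OF sm(2) this u0 step order_refl]
      have agree: "curves_agree (Suc k) (u L i) (v i)" if "i \<in> {1..s}" for i
        using that less.prems by (metis Suc_leI min.absorb2)
      \<comment> \<open>This makes \<open>x\<close> the point at which the fields of index
        \<open>k\<close> are compared.\<close>
      have base: "(\<chi> d. fps_nth (v i $ d) 0) = x" if "i \<in> {1..s}" for i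
        by (simp add: vec_eq_iff) (subst v[OF that], simp only: stage_nth nat.case, simp)
      show "f_hat k x = f_unr k x"
      proof (rule vec_eq_iff[THEN iffD2], rule allI)
        fix d
        \<comment> \<open>Both outputs equal the Taylor series of the flow; coefficient
          \<open>Suc k\<close> is compared.\<close>
        have "(\<Sum>i=1..s. b i * fps_nth (formal_eval f_hat (v i) $ d) k) =
            (\<Sum>i=1..s. b i * fps_nth (formal_eval f_unr (u L i) $ d) k)"
          using arg_cong[OF trans[OF P_hat[symmetric] P_unr], of "\<lambda>c. fps_nth (c $ d) (Suc k)"]
          by (simp only: rk_output_def stage_nth nat.case)
        also have "\<dots> = (\<Sum>i=1..s. b i * fps_nth (formal_eval f_unr (v i) $ d) k)"
        proof (intro sum.cong refl arg_cong2[where f = "(*)"] formal_eval_nth_cong)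
          fix i m d assume "i \<in> {1..s}" "m \<le> k"
          then show "fps_nth (u L i $ d) m = fps_nth (v i $ d) m"
            using curves_agreeD[OF agree] by simp
        qed
        finally have "0 = (\<Sum>i=1..s. b i * (fps_nth (formal_eval f_hat (v i) $ d) k -
            fps_nth (formal_eval f_unr (v i) $ d) k))"
          by (simp add: right_diff_distrib sum_subtractf)
        \<comment> \<open>Both substitutions now use the same stages \<open>v i\<close>, so only the
          fields of index \<open>k\<close> can differ.\<close>
        also have "\<dots> = (\<Sum>i=1..s. b i * (f_hat k x - f_unr k x) $ d)"
        proof (intro sum.cong refl)
          fix i assume "i \<in> {1..s}"
          then show "b i * (fps_nth (formal_eval f_hat (v i) $ d) k -
              fps_nth (formal_eval f_unr (v i) $ d) k) = b i * (f_hat k x - f_unr k x) $ d"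
            by (simp only: formal_eval_nth_diff[OF sm eq] base)
        qed
        also have "\<dots> = (f_hat k x - f_unr k x) $ d"
          using assms(3) by (simp add: rk_consistent_def flip: sum_distrib_right)
        finally show "f_hat k x $ d = f_unr k x $ d" by simp
      qed
    qed
  qed
qed

end
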